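(* Let $(X,d_X)$ be a metric space and let $(Y,\rho_Y)$ be a (non-empty) quasi-metric space. If $m\geq 1$ is an integer, then $$e^{m}(X,Y)\leq m+1.$$
   Context: A quasi-metric space $(Y,\rho_Y)$ is a set $Y$ with a function $\rho_Y\colon Y\times Y\to\mathbb{R}$ that is non-negative, symmetric and vanishes on the diagonal (no triangle inequality is required, and $\rho_Y(y,y')=0$ is allowed for $y\ne y'$). For a subset $S\subset X$ and a map $f\colon S\to Y$, put $$\operatorname{Lip}(f):=\inf\{L\geq 0:\ \rho_Y(f(x),f(x'))\leq L\,d_X(x,x')\text{ for all }x,x'\in S\},$$ with $\inf\varnothing=+\infty$; $f$ is called Lipschitz if $\operatorname{Lip}(f)<\infty$. For a metric space $Z$ and a subset $S\subset Z$, $e(Z,S;Y)$ denotes the infimum (with $\inf\varnothing=+\infty$) of all real numbers $D\geq 1$ such that every Lipschitz map $f\colon S\to Y$ has a Lipschitz extension $\overline{f}\colon Z\to Y$ with $\operatorname{Lip}(\overline{f})\leq D\operatorname{Lip}(f)$. For an integer $m\geq 1$, $$e^m(X,Y):=\sup\{e(S\cup T,S;Y):\ S,T\subset X,\ S\text{ closed in }X,\ |T|\leq m\},$$ where $S\cup T$ carries the metric induced from $X$, and $|\cdot|$ denotes cardinality. *)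

theory Defs
  imports "HOL-Analysis.Abstract_Metric_Spaces" "HOL-Library.Extended_Real" "HOL-Library.FuncSet"
begin

locale Quasi_metric_space =
  fixes Y :: "'b set" and \<rho> :: "'b \<Rightarrow> 'b \<Rightarrow> real"
  assumes nonneg: "\<lbrakk>y \<in> Y; y' \<in> Y\<rbrakk> \<Longrightarrow> 0 \<le> \<rho> y y'"
    and commute: "\<lbrakk>y \<in> Y; y' \<in> Y\<rbrakk> \<Longrightarrow> \<rho> y y' = \<rho> y' y"
    and diagonal: "y \<in> Y \<Longrightarrow> \<rho> y y = 0"

text \<open>Throughout, a map from \<open>S\<close> to \<open>Y\<close> is a total HOL function of which only the values
  on \<open>S\<close> matter, and a subset of a metric space is given the induced metric by using the same
  distance function \<open>d\<close>. Infima and suprema are taken in the extended reals, where the infimum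
  of the empty set is \<open>\<infinity>\<close>.\<close>

definition Lip :: "('a \<Rightarrow> 'a \<Rightarrow> real) \<Rightarrow> ('b \<Rightarrow> 'b \<Rightarrow> real) \<Rightarrow> 'a set \<Rightarrow> ('a \<Rightarrow> 'b) \<Rightarrow> ereal" where
  "Lip d \<rho> S f =
     Inf {ereal L | L. 0 \<le> L \<and> (\<forall>x\<in>S. \<forall>x'\<in>S. \<rho> (f x) (f x') \<le> L * d x x')}"

definition Lipschitz_map ::
    "('a \<Rightarrow> 'a \<Rightarrow> real) \<Rightarrow> ('b \<Rightarrow> 'b \<Rightarrow> real) \<Rightarrow> 'a set \<Rightarrow> 'b set \<Rightarrow> ('a \<Rightarrow> 'b) \<Rightarrow> bool" where
  "Lipschitz_map d \<rho> S Y f \<longleftrightarrow> f \<in> S \<rightarrow> Y \<and> Lip d \<rho> S f < \<infinity>"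

definition ext_modulus ::
    "('a \<Rightarrow> 'a \<Rightarrow> real) \<Rightarrow> ('b \<Rightarrow> 'b \<Rightarrow> real) \<Rightarrow> 'a set \<Rightarrow> 'a set \<Rightarrow> 'b set \<Rightarrow> ereal" where
  "ext_modulus d \<rho> Z S Y =
     Inf {ereal D | D. 1 \<le> D \<and>
       (\<forall>f. Lipschitz_map d \<rho> S Y f \<longrightarrow>
         (\<exists>g. Lipschitz_map d \<rho> Z Y g \<and> (\<forall>x\<in>S. g x = f x) \<and>
              Lip d \<rho> Z g \<le> ereal D * Lip d \<rho> S f))}"

definition finite_ext_modulus ::
    "nat \<Rightarrow> 'a set \<Rightarrow> ('a \<Rightarrow> 'a \<Rightarrow> real) \<Rightarrow> 'b set \<Rightarrow> ('b \<Rightarrow> 'b \<Rightarrow> real) \<Rightarrow> ereal" where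
  "finite_ext_modulus m X d Y \<rho> =
     Sup {ext_modulus d \<rho> (S \<union> T) S Y | S T.
       S \<subseteq> X \<and> T \<subseteq> X \<and> closedin (Metric_space.mtopology X d) S \<and> finite T \<and> card T \<le> m}"

end

theory Submission
  imports Defs
begin

text \<open>
  The target \<open>Y\<close> has no structure to speak of, so an extension of \<open>f\<close> from \<open>S\<close> to \<open>S \<union> T\<close> has to
  come from the domain: it is \<open>f \<circ> r\<close> for a retraction \<open>r\<close> of \<open>S \<union> T\<close> onto \<open>S\<close>. The theorem
  reduces, for \<open>S \<noteq> {}\<close>, to finding for each \<open>c > 1\<close> a retraction with Lipschitz constant \<open>(m + 1) c\<close>.

  Composing \<open>m\<close> retractions, each of which moves a single point to a nearest remaining one, would
  only give a constant exponential in \<open>m\<close>. Instead, join the points of \<open>T\<close> to \<open>S\<close> by a minimal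
  spanning forest, in which the points of \<open>S\<close> are the roots, and let \<open>r\<close> send each point to the root of its tree.
  If \<open>t\<close> and \<open>x\<close> lie in different trees, then by minimality every edge on the way from \<open>t\<close> or from
  \<open>x\<close> to its root has length at most \<open>d t x\<close>. These two paths are disjoint and together have at
  most \<open>m\<close> edges, since each edge leads up from its own point of \<open>T\<close>. The triangle
  inequality along the walk from \<open>r t\<close> to \<open>t\<close> to \<open>x\<close> to \<open>r x\<close> yields \<open>d (r t) (r x) \<le> (m + 1) d t x\<close>.

  The forest is grown by Prim's algorithm, whose invariants are collected in \<open>prim_forest\<close>.
  They suffice to run the argument without handling trees or paths as objects
  (\<open>prim_forest_step\<close>, \<open>minimal_forest\<close>). As \<open>S\<close> may be infinite and distances to it need not be
  attained, the roots are restricted to finitely many points of \<open>S\<close>, among them for each point of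
  \<open>T - S\<close> one that is nearest up to the factor \<open>c\<close>; this is where \<open>S\<close> being closed enters (\<open>near_nearest_point\<close>,
  \<open>retraction_to_closed\<close>).
\<close>

section \<open>Growing a minimal spanning forest\<close>

text \<open>
  A stage of Prim's algorithm: \<open>F\<close> are the roots, \<open>T\<close> the points to be joined to them, \<open>A\<close> those
  already joined. The value \<open>r t\<close> is the root of the tree of \<open>t\<close>, and \<open>h t\<close> is the length of the
  longest edge between \<open>t\<close> and that root. The path from \<open>t\<close> to its root has at most
  as many edges as its tree has points in \<open>A\<close>, whence the bound on \<open>d t (r t)\<close>. The fourth
  condition is minimality. The last one makes it survive later steps. It holds because the algorithm uses an edge of length \<open>h u\<close> only when no
  shorter one leaves the current forest. From then on, as long as shorter edges leave the forest,
  they start at points below that edge, in the tree of \<open>u\<close>, and one of them is used next; once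
  there are none, all that appear later start at points added after \<open>u\<close>, and none at \<open>u\<close> itself.
\<close>

definition (in Metric_space) prim_forest ::
    "'a set \<Rightarrow> 'a set \<Rightarrow> 'a set \<Rightarrow> ('a \<Rightarrow> 'a) \<Rightarrow> ('a \<Rightarrow> real) \<Rightarrow> bool" where
  "prim_forest F T A r h \<longleftrightarrow>
     A \<subseteq> T \<and>
     (\<forall>s\<in>F. r s = s \<and> h s = 0) \<and>
     (\<forall>t\<in>A. r t \<in> F \<and> 0 \<le> h t \<and> d t (r t) \<le> real (card {a\<in>A. r a = r t}) * h t) \<and>
     (\<forall>t\<in>F \<union> A. \<forall>x\<in>F \<union> A. r t \<noteq> r x \<longrightarrow> h t \<le> d t x) \<and>
     (\<forall>u\<in>F \<union> A. \<forall>u'\<in>F \<union> A. \<forall>z\<in>T - A. \<forall>z'\<in>T - A.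
        d u z < h u \<longrightarrow> d u' z' < h u \<longrightarrow> r u = r u')"

text \<open>
  The new point \<open>y\<close> and its parent \<open>p\<close> realise the least distance between the forest and the
  points not yet joined. For \<open>u\<close> in another tree than \<open>p\<close>, both \<open>u\<close> and \<open>p\<close> thus have \<open>y\<close>
  within distance \<open>d u y\<close>; the last invariant would put them into one tree
  if \<open>h u\<close> or \<open>h p\<close> exceeded \<open>d u y\<close>. This gives minimality for the pairs that involve \<open>y\<close>.
\<close>

lemma (in Metric_space) prim_forest_step:
  assumes "finite F" "F \<noteq> {}" "finite T" "F \<subseteq> M" "T \<subseteq> M" "F \<inter> T = {}"
    and forest: "prim_forest F T A r h" and "A \<noteq> T"
  obtains y r' h' where "y \<in> T - A" "prim_forest F T (insert y A) r' h'"
proof -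
  have A: "A \<subseteq> T"
    and root: "\<And>s. s \<in> F \<Longrightarrow> r s = s" "\<And>s. s \<in> F \<Longrightarrow> h s = 0"
    and rA: "\<And>t. t \<in> A \<Longrightarrow> r t \<in> F" and hA: "\<And>t. t \<in> A \<Longrightarrow> 0 \<le> h t"
    and path: "\<And>t. t \<in> A \<Longrightarrow> d t (r t) \<le> real (card {a\<in>A. r a = r t}) * h t"
    and minimal: "\<And>t x. \<lbrakk>t \<in> F \<union> A; x \<in> F \<union> A; r t \<noteq> r x\<rbrakk> \<Longrightarrow> h t \<le> d t x"
    and short: "\<And>u u' z z'. \<lbrakk>u \<in> F \<union> A; u' \<in> F \<union> A; z \<in> T - A; z' \<in> T - A;
      d u z < h u; d u' z' < h u\<rbrakk> \<Longrightarrow> r u = r u'"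
    using forest unfolding prim_forest_def by blast+
  have finA: "finite A" using A \<open>finite T\<close> finite_subset by blast
  have h0: "0 \<le> h u" and rF: "r u \<in> F" if "u \<in> F \<union> A" for u
    using that root hA rA by auto
  define P where "P = (F \<union> A) \<times> (T - A)"
  have "finite P" "P \<noteq> {}"
    using assms finA A by (auto simp: P_def)
  then have "\<exists>e\<in>P. \<forall>e'\<in>P. d (fst e) (snd e) \<le> d (fst e') (snd e')"
    using ex_min_if_finite[of "(\<lambda>e. d (fst e) (snd e)) ` P"] by (auto simp: not_less)
  then obtain p y where p: "p \<in> F \<union> A" and y: "y \<in> T - A"
    and least: "\<And>u z. \<lbrakk>u \<in> F \<union> A; z \<in> T - A\<rbrakk> \<Longrightarrow> d p y \<le> d u z"
    unfolding P_def by force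
  have inM: "p \<in> M" "y \<in> M" "r p \<in> M" using p y A rF[OF p] assms by auto
  have ny: "y \<notin> F" "y \<notin> A" using y assms by auto
  define B where "B = insert y A"
  define r' where "r' = r(y := r p)"
  define h' where "h' = h(y := max (h p) (d p y))"
  have old: "r' u = r u" "h' u = h u" if "u \<in> F \<union> A" for u
    using that ny by (auto simp: r'_def h'_def)
  have new: "r' y = r p" "h' y = max (h p) (d p y)" by (auto simp: r'_def h'_def)
  have "d t (r' t) \<le> real (card {a\<in>B. r' a = r' t}) * h' t" if "t \<in> B" for t
  proof (cases "t = y")
    case True
    have "{a\<in>B. r' a = r' y} = insert y {a\<in>A. r a = r p}"
      using ny old new by (auto simp: B_def)
    then have card: "card {a\<in>B. r' a = r' y} = Suc (card {a\<in>A. r a = r p})"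
      using finA ny by simp
    have "d p (r p) \<le> real (card {a\<in>A. r a = r p}) * h p"
    proof (cases "p \<in> A")
      case False
      then show ?thesis using p root inM by auto
    qed (rule path)
    also have "\<dots> \<le> real (card {a\<in>A. r a = r p}) * h' y"
      using new by (intro mult_left_mono) auto
    finally have "d p (r p) \<le> real (card {a\<in>A. r a = r p}) * h' y" .
    moreover have "d y (r p) \<le> d p y + d p (r p)"
      using triangle[OF inM(2,1,3)] commute by metis
    moreover have "d p y \<le> h' y" using new by simp
    ultimately show ?thesis
      unfolding True card unfolding new(1) by (simp add: algebra_simps)
  next
    case False
    then have t: "t \<in> A" using that by (simp add: B_def)
    have "{a\<in>A. r a = r t} \<subseteq> {a\<in>B. r' a = r' t}"
      using old t by (auto simp: B_def)
    then have "card {a\<in>A. r a = r t} \<le> card {a\<in>B. r' a = r' t}"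
      using finA by (intro card_mono) (auto simp: B_def)
    then have "real (card {a\<in>A. r a = r t}) * h t \<le> real (card {a\<in>B. r' a = r' t}) * h t"
      using hA[OF t] by (intro mult_right_mono) auto
    then show ?thesis using path[OF t] old t by simp
  qed
  moreover have "r' t \<in> F \<and> 0 \<le> h' t" if "t \<in> B" for t
    using that old new rF h0 p unfolding B_def by (cases "t = y") (auto simp: le_max_iff_disj)
  moreover have "h' t \<le> d t x" if tx: "t \<in> F \<union> B" "x \<in> F \<union> B" "r' t \<noteq> r' x" for t x
  proof -
    have other: "h u \<le> d u y" "h p \<le> d u y" if u: "u \<in> F \<union> A" "r u \<noteq> r p" for u
    proof -
      have "d p y \<le> d u y" using least u y by blast
      then show "h u \<le> d u y" "h p \<le> d u y"
        using short[of u p y y] short[of p u y y] u p y by fastforce+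
    qed
    consider "t \<in> F \<union> A" "x \<in> F \<union> A" | "t \<in> F \<union> A" "x = y" | "t = y" "x \<in> F \<union> A"
      using tx by (auto simp: B_def)
    then show ?thesis
    proof cases
      case 1
      then show ?thesis using minimal tx old by simp
    next
      case 2
      then show ?thesis using other tx old new by simp
    next
      case 3
      then have "h p \<le> d x y" "d p y \<le> d x y"
        using other(2)[of x] tx old new least y by auto
      then show ?thesis using 3 new by (simp add: commute)
    qed
  qed
  moreover have "r' u = r' u'"
    if uu: "u \<in> F \<union> B" "u' \<in> F \<union> B" and z: "z \<in> T - B" "z' \<in> T - B"
      and lt: "d u z < h' u" "d u' z' < h' u" for u u' z z'
  proof -
    have z': "z \<in> T - A" "z' \<in> T - A" using z by (auto simp: B_def)
    consider "u \<in> F \<union> A" "u' \<in> F \<union> A" | "u \<in> F \<union> A" "u' = y" | "u = y" "u' \<in> F \<union> A"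
      | "u = y" "u' = y"
      using uu by (auto simp: B_def)
    then show ?thesis
    proof cases
      case 1
      then show ?thesis using short[of u u' z z'] z' lt old by simp
    next
      case 2
      \<comment> \<open>The edge just added is no longer than \<open>d u z\<close>, so \<open>p\<close> can take the place of \<open>y\<close>.\<close>
      then have "d p y < h u" using least[of u z] z' lt old by simp
      then show ?thesis using 2 short[of u p z y] z' y p lt old new by simp
    next
      case 3
      \<comment> \<open>The new edge is no longer than \<open>d u' z'\<close>, so \<open>h' y\<close> comes from \<open>p\<close>.\<close>
      then have "d p y \<le> d u' z'" using least[of u' z'] z' by simp
      then have "d u' z' < h p" "d p y < h p" using lt 3 new by auto
      then show ?thesis using 3 short[of p u' y z'] z' y p old new by simp
    next
      case 4
      then show ?thesis by simp
    qed
  qed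
  moreover have "B \<subseteq> T" using A y by (auto simp: B_def)
  ultimately have "prim_forest F T B r' h'"
    unfolding prim_forest_def using root old by simp
  then show thesis using that y by (simp add: B_def)
qed

lemma (in Metric_space) minimal_forest:
  assumes "finite F" "F \<noteq> {}" "finite T" "F \<subseteq> M" "T \<subseteq> M" "F \<inter> T = {}"
  obtains r h where "prim_forest F T T r h"
proof -
  have "\<exists>A r h. prim_forest F T A r h \<and> card A = k" if "k \<le> card T" for k
    using that
  proof (induction k)
    case 0
    have "prim_forest F T {} id (\<lambda>_. 0)"
      using assms by (simp add: prim_forest_def) (metis nonneg not_less)
    then show ?case by (metis card.empty)
  next
    case (Suc k)
    then obtain A r h where A: "prim_forest F T A r h" "card A = k" by auto
    have "A \<subseteq> T" using A(1) by (simp only: prim_forest_def)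
    then have "finite A" using assms(3) finite_subset by blast
    have "A \<noteq> T" using A(2) Suc.prems by auto
    obtain y r' h' where "y \<in> T - A" "prim_forest F T (insert y A) r' h'"
      using prim_forest_step[OF assms A(1) \<open>A \<noteq> T\<close>] .
    moreover from this have "card (insert y A) = Suc k"
      using A(2) \<open>finite A\<close> by simp
    ultimately show ?case by blast
  qed
  then obtain A r h where "prim_forest F T A r h" "card A = card T" by blast
  moreover from this have "A \<subseteq> T" by (simp only: prim_forest_def)
  ultimately show thesis
    using that card_subset_eq[OF assms(3)] by metis
qed

section \<open>Retracting onto a closed set\<close>

lemma (in Metric_space) near_nearest_point:
  assumes "closedin mtopology S" "S \<noteq> {}" "t \<in> M - S" "1 < c"
  obtains s where "s \<in> S" "\<And>x. x \<in> S \<Longrightarrow> d t s \<le> c * d t x"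
proof -
  \<comment> \<open>The distance from \<open>t\<close> to \<open>S\<close>; it is positive because \<open>S\<close> is closed.\<close>
  define \<delta> where "\<delta> = Inf (d t ` S)"
  obtain e where e: "0 < e" "disjnt S (mball t e)"
    using assms closedin_metric by blast
  have "S \<subseteq> M" using assms(1) closedin_subset by fastforce
  then have "e \<le> d t x" if "x \<in> S" for x
    using that e assms(3) by (force simp: disjnt_iff)
  then have "e \<le> \<delta>"
    unfolding \<delta>_def using assms(2) by (intro cINF_greatest) auto
  then have "\<delta> < c * \<delta>" using e assms(4) by simp
  then obtain s where s: "s \<in> S" "d t s < c * \<delta>"
    unfolding \<delta>_def using cInf_lessD[of "d t ` S"] assms(2) by blast
  have "\<delta> \<le> d t x" if "x \<in> S" for x
    unfolding \<delta>_def using that by (intro cINF_lower) (auto intro!: bdd_belowI[of _ 0])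
  then show thesis
    using that[OF s(1)] s(2) assms(4) by (smt (verit) mult_left_mono)
qed

text \<open>
  With near-nearest points \<open>s t\<close> as roots, the comparison of \<open>t\<close> with a point \<open>x\<close> of \<open>S\<close> that
  is not a root goes through \<open>s t\<close>: either \<open>s t\<close> is itself the root of \<open>t\<close>, or it lies in
  another tree and minimality applies to \<open>t\<close> and \<open>s t\<close>.
\<close>

lemma (in Metric_space) retraction_to_closed:
  assumes S: "closedin mtopology S" "S \<noteq> {}"
    and T: "finite T" "T \<subseteq> M" "card T \<le> m" and c: "1 < c"
  obtains r where "r \<in> S \<union> T \<rightarrow> S" "\<And>x. x \<in> S \<Longrightarrow> r x = x"
    "\<And>x x'. \<lbrakk>x \<in> S \<union> T; x' \<in> S \<union> T\<rbrakk> \<Longrightarrow> d (r x) (r x') \<le> (real m + 1) * c * d x x'"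
proof -
  have SM: "S \<subseteq> M" using S closedin_subset by fastforce
  define U where "U = T - S"
  have "\<exists>s\<in>S. \<forall>x\<in>S. d t s \<le> c * d t x" if "t \<in> U" for t
    using near_nearest_point[OF S _ c, of t] that T by (metis DiffD1 DiffD2 DiffI U_def subsetD)
  then obtain s where s: "\<And>t. t \<in> U \<Longrightarrow> s t \<in> S"
    and near: "\<And>t x. \<lbrakk>t \<in> U; x \<in> S\<rbrakk> \<Longrightarrow> d t (s t) \<le> c * d t x"
    by metis
  obtain s0 where "s0 \<in> S" using S by blast
  define F where "F = insert s0 (s ` U)"
  have FS: "F \<subseteq> S" using s \<open>s0 \<in> S\<close> by (auto simp: F_def)
  have U: "finite U" "U \<subseteq> M" "F \<inter> U = {}" "card U \<le> m"
    using T FS card_mono[of T U] by (auto simp: U_def)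
  have "finite F" "F \<noteq> {}" "F \<subseteq> M"
    using FS SM U by (auto simp: F_def)
  then obtain q h where forest: "prim_forest F U U q h"
    using minimal_forest U by metis
  have qF: "\<And>x. x \<in> F \<Longrightarrow> q x = x"
    and q: "\<And>t. t \<in> U \<Longrightarrow> q t \<in> F"
    and path: "\<And>t. t \<in> U \<Longrightarrow> d t (q t) \<le> real (card {a\<in>U. q a = q t}) * h t"
    and minimal: "\<And>t x. \<lbrakk>t \<in> F \<union> U; x \<in> F \<union> U; q t \<noteq> q x\<rbrakk> \<Longrightarrow> h t \<le> d t x"
    using forest unfolding prim_forest_def by simp_all
  define N where "N v = real (card {a\<in>U. q a = v})" for v
  have N_le: "N v \<le> real m" for v
    using card_mono[of U "{a\<in>U. q a = v}"] U by (simp add: N_def)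
  have N_add: "N v + N w \<le> real m" if "v \<noteq> w" for v w
  proof -
    have "card {a\<in>U. q a = v} + card {a\<in>U. q a = w} =
        card ({a\<in>U. q a = v} \<union> {a\<in>U. q a = w})"
      using U that by (intro card_Un_disjoint[symmetric]) auto
    also have "\<dots> \<le> card U" using U by (intro card_mono) auto
    finally show ?thesis using U by (simp add: N_def)
  qed
  have to_S: "d t (q t) \<le> N (q t) * (c * d t x)" if t: "t \<in> U" and x: "x \<in> S" for t x
  proof (cases "q t = s t")
    case True
    \<comment> \<open>The tree of \<open>t\<close> contains at least \<open>t\<close> itself.\<close>
    have "t \<in> {a\<in>U. q a = q t}" using t by simp
    then have "1 \<le> N (q t)"
      unfolding N_def using U by (simp add: Suc_le_eq card_gt_0_iff) blast
    moreover have "0 \<le> c * d t x" using c by simp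
    ultimately have "1 * (c * d t x) \<le> N (q t) * (c * d t x)"
      by (rule mult_right_mono)
    then show ?thesis using near[OF t x] True by simp
  next
    case False
    have st: "s t \<in> F" using t by (simp add: F_def)
    then have "h t \<le> d t (s t)" using minimal[of t "s t"] False t qF by simp
    also have "\<dots> \<le> c * d t x" using near t x by blast
    finally have "N (q t) * h t \<le> N (q t) * (c * d t x)"
      by (intro mult_left_mono) (auto simp: N_def)
    then show ?thesis using path[OF t] by (simp add: N_def)
  qed
  have to_U: "d t (q t) \<le> N (q t) * (c * d t x)"
    if t: "t \<in> U" and x: "x \<in> U" "q t \<noteq> q x" for t x
  proof -
    have "h t \<le> 1 * d t x" using minimal that by simp
    also have "\<dots> \<le> c * d t x" using c by (intro mult_right_mono) auto
    finally have "N (q t) * h t \<le> N (q t) * (c * d t x)"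
      by (intro mult_left_mono) (auto simp: N_def)
    then show ?thesis using path[OF t] by (simp add: N_def)
  qed
  have D: "a + d x x' \<le> (real m + 1) * c * d x x'" if "a \<le> n * (c * d x x')" "n \<le> real m" for a n x x'
  proof -
    have "n * (c * d x x') \<le> real m * (c * d x x')"
      using that c by (intro mult_right_mono) auto
    moreover have "1 * d x x' \<le> c * d x x'" using c by (intro mult_right_mono) auto
    ultimately show ?thesis using that by (simp add: algebra_simps)
  qed
  have US: "d (q t) x \<le> (real m + 1) * c * d t x" if "t \<in> U" "x \<in> S" for t x
  proof -
    have "d (q t) x \<le> d t (q t) + d t x"
      using triangle'[of "q t" t x] that q FS SM U commute by (metis subsetD triangle)
    also have "\<dots> \<le> (real m + 1) * c * d t x"
      using to_S that N_le by (intro D) auto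
    finally show ?thesis .
  qed
  have UU: "d (q t) (q x) \<le> (real m + 1) * c * d t x" if "t \<in> U" "x \<in> U" for t x
  proof (cases "q t = q x")
    case True
    then show ?thesis using q[OF that(2)] FS SM c by auto
  next
    case False
    have inM: "t \<in> M" "x \<in> M" "q t \<in> M" "q x \<in> M"
      using that q FS SM U by auto
    have "d (q t) (q x) \<le> d (q t) t + d t (q x)" "d t (q x) \<le> d t x + d x (q x)"
      using inM triangle by auto
    then have "d (q t) (q x) \<le> (d t (q t) + d x (q x)) + d t x"
      by (simp add: commute)
    also have "\<dots> \<le> (real m + 1) * c * d t x"
    proof (rule D)
      show "d t (q t) + d x (q x) \<le> (N (q t) + N (q x)) * (c * d t x)"
        using to_U[of t x] to_U[of x t] that False by (simp add: commute algebra_simps)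
    qed (rule N_add[OF False])
    finally show ?thesis .
  qed
  have SS: "d x x' \<le> (real m + 1) * c * d x x'" for x x'
    using D[of 0 0 x x'] by simp
  define r where "r x = (if x \<in> S then x else q x)" for x
  show thesis
  proof
    show "r \<in> S \<union> T \<rightarrow> S" using q FS by (auto simp: r_def U_def subset_iff)
    show "r x = x" if "x \<in> S" for x using that by (simp add: r_def)
    show "d (r x) (r x') \<le> (real m + 1) * c * d x x'" if "x \<in> S \<union> T" "x' \<in> S \<union> T" for x x'
    proof -
      have "x \<in> S \<or> x \<in> U" "x' \<in> S \<or> x' \<in> U" using that by (auto simp: U_def)
      then show ?thesis
        using US[of x x'] US[of x' x] UU[of x x'] SS[of x x']
        by (auto simp: r_def commute)
    qed
  qed
qed

section \<open>Extending along a retraction\<close>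

lemma Lip_le:
  assumes "0 \<le> L" "\<And>x x'. \<lbrakk>x \<in> S; x' \<in> S\<rbrakk> \<Longrightarrow> \<rho> (f x) (f x') \<le> L * d x x'"
  shows "Lip d \<rho> S f \<le> ereal L"
  unfolding Lip_def using assms by (intro Inf_lower) auto

lemma Lip_comp_le:
  assumes "0 < D" "r \<in> Z \<rightarrow> S"
    and r: "\<And>x x'. \<lbrakk>x \<in> Z; x' \<in> Z\<rbrakk> \<Longrightarrow> d (r x) (r x') \<le> D * d x x'"
  shows "Lip d \<rho> Z (f \<circ> r) \<le> ereal D * Lip d \<rho> S f"
proof -
  have "Lip d \<rho> Z (f \<circ> r) / ereal D \<le> Lip d \<rho> S f"
    unfolding Lip_def[of d \<rho> S f]
  proof (rule Inf_greatest, clarify)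
    fix L assume L: "0 \<le> L" "\<forall>x\<in>S. \<forall>x'\<in>S. \<rho> (f x) (f x') \<le> L * d x x'"
    have "Lip d \<rho> Z (f \<circ> r) \<le> ereal (D * L)"
    proof (rule Lip_le)
      fix x x' assume x: "x \<in> Z" "x' \<in> Z"
      then have "\<rho> ((f \<circ> r) x) ((f \<circ> r) x') \<le> L * d (r x) (r x')"
        using L assms(2) by auto
      also have "\<dots> \<le> L * (D * d x x')" using L(1) r x by (intro mult_left_mono) auto
      finally show "\<rho> ((f \<circ> r) x) ((f \<circ> r) x') \<le> D * L * d x x'"
        by (simp add: ac_simps)
    qed (use L assms in simp)
    then show "Lip d \<rho> Z (f \<circ> r) / ereal D \<le> ereal L"
      using assms(1) by (simp add: ereal_divide_le_pos)
  qed
  then show ?thesis using assms(1) by (simp add: ereal_divide_le_pos)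
qed

lemma ext_modulus_le_of_retraction:
  assumes "1 \<le> D" "r \<in> Z \<rightarrow> S" "\<And>x. x \<in> S \<Longrightarrow> r x = x"
    and "\<And>x x'. \<lbrakk>x \<in> Z; x' \<in> Z\<rbrakk> \<Longrightarrow> d (r x) (r x') \<le> D * d x x'"
  shows "ext_modulus d \<rho> Z S Y \<le> ereal D"
proof -
  have "Lipschitz_map d \<rho> Z Y (f \<circ> r)" "Lip d \<rho> Z (f \<circ> r) \<le> ereal D * Lip d \<rho> S f"
    if f: "Lipschitz_map d \<rho> S Y f" for f
  proof -
    show le: "Lip d \<rho> Z (f \<circ> r) \<le> ereal D * Lip d \<rho> S f"
      using assms by (intro Lip_comp_le) auto
    moreover have "ereal D * Lip d \<rho> S f < \<infinity>"
      using f assms(1) unfolding Lipschitz_map_def by (cases "Lip d \<rho> S f") auto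
    ultimately have "Lip d \<rho> Z (f \<circ> r) < \<infinity>" by (rule le_less_trans)
    moreover have "f \<circ> r \<in> Z \<rightarrow> Y"
      using f assms(2) unfolding Lipschitz_map_def by (auto simp: Pi_iff)
    ultimately show "Lipschitz_map d \<rho> Z Y (f \<circ> r)" by (simp add: Lipschitz_map_def)
  qed
  moreover have "\<forall>x\<in>S. (f \<circ> r) x = f x" for f :: "'a \<Rightarrow> 'b" using assms(3) by simp
  ultimately have "\<exists>g. Lipschitz_map d \<rho> Z Y g \<and> (\<forall>x\<in>S. g x = f x) \<and>
      Lip d \<rho> Z g \<le> ereal D * Lip d \<rho> S f" if "Lipschitz_map d \<rho> S Y f" for f
    using that by blast
  then show ?thesis
    unfolding ext_modulus_def using assms(1) by (intro Inf_lower) auto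
qed

text \<open>
  There is no retraction onto the empty set; here a constant map extends every \<open>f\<close>.
\<close>

lemma ext_modulus_empty_le:
  assumes "Quasi_metric_space Y \<rho>" "Y \<noteq> {}"
  shows "ext_modulus d \<rho> Z {} Y \<le> 1"
proof -
  obtain y where y: "y \<in> Y" using assms by blast
  have "Lip d \<rho> Z (\<lambda>_. y) \<le> ereal 0"
    using Quasi_metric_space.diagonal[OF assms(1) y] by (intro Lip_le) auto
  moreover have "0 \<le> Lip d \<rho> {} f" for f
    unfolding Lip_def by (rule Inf_greatest) auto
  ultimately have "Lip d \<rho> Z (\<lambda>_. y) \<le> ereal 1 * Lip d \<rho> {} f" for f
    by (metis mult_1 one_ereal_def order_trans zero_ereal_def)
  moreover have "Lipschitz_map d \<rho> Z Y (\<lambda>_. y)"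
    unfolding Lipschitz_map_def using y \<open>Lip d \<rho> Z (\<lambda>_. y) \<le> ereal 0\<close>
    by (auto intro: le_less_trans)
  ultimately show ?thesis
    unfolding ext_modulus_def one_ereal_def by (intro Inf_lower) auto
qed

theorem theorem1p1:
  fixes X :: "'a set" and d :: "'a \<Rightarrow> 'a \<Rightarrow> real"
    and Y :: "'b set" and \<rho> :: "'b \<Rightarrow> 'b \<Rightarrow> real"
    and m :: nat
  assumes "Metric_space X d"
    and "Quasi_metric_space Y \<rho>"
    and "Y \<noteq> {}"
    and "m \<ge> 1"
  shows "finite_ext_modulus m X d Y \<rho> \<le> ereal (real m + 1)"
proof -
  interpret Metric_space X d by (rule assms(1))
  have "ext_modulus d \<rho> (S \<union> T) S Y \<le> ereal (real m + 1)"
    if S: "closedin mtopology S" and T: "T \<subseteq> X" "finite T" "card T \<le> m" for S T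
  proof (cases "S = {}")
    case True
    have "ext_modulus d \<rho> (S \<union> T) S Y \<le> 1"
      unfolding True using assms by (intro ext_modulus_empty_le)
    also have "\<dots> \<le> ereal (real m + 1)" by (simp add: one_ereal_def)
    finally show ?thesis .
  next
    case False
    show ?thesis
    proof (rule ereal_le_epsilon2)
      fix e :: real assume e: "0 < e"
      \<comment> \<open>Chosen so that \<open>(real m + 1) * c = real m + 1 + e\<close>.\<close>
      define c where "c = 1 + e / (real m + 1)"
      have "1 < c" and c: "(real m + 1) * c = real m + 1 + e"
        using e by (auto simp: c_def field_simps)
      then obtain r where "r \<in> S \<union> T \<rightarrow> S" "\<And>x. x \<in> S \<Longrightarrow> r x = x"
        "\<And>x x'. \<lbrakk>x \<in> S \<union> T; x' \<in> S \<union> T\<rbrakk> \<Longrightarrow> d (r x) (r x') \<le> (real m + 1 + e) * d x x'"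
        using retraction_to_closed[OF S False T(2,1,3)] by metis
      then have "ext_modulus d \<rho> (S \<union> T) S Y \<le> ereal (real m + 1 + e)"
        using e by (intro ext_modulus_le_of_retraction[where r = r]) auto
      then show "ext_modulus d \<rho> (S \<union> T) S Y \<le> ereal (real m + 1) + ereal e" by simp
    qed
  qed
  then show ?thesis
    unfolding finite_ext_modulus_def by (intro Sup_least) auto
qed

end
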